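(* Let $n\ge4$ and let $S$ be an inductive strategy of length $n$ with $S[n]\neq[n,1,2,\dots,n-1]$ (i.e. $S\neq CSL$). Let $N_S$ (resp. $N_{CSL}$) be the number of permutations $\pi\in S_n$ such that the game with strategy $S$ (resp. $CSL$) and secret $\pi$ ends after exactly three guesses and $\rho_S(\pi)=2$ (resp. $\rho_{CSL}(\pi)=2$). Then $N_S>N_{CSL}$.
   Context: Permutation wordle on $[n]=\{1,\dots,n\}$: a secret permutation $\pi\in S_n$ (one-line notation) is fixed. The first guess is $\gamma_1=[1,2,\dots,n]$. After guess $\gamma_r$ the guesser learns $\mathcal{J}_r=\{i:\gamma_r(i)=\pi(i)\}$; $\mathcal{I}_r=[n]\setminus\mathcal{J}_r$. The game ends at the first $r$ with $\mathcal{J}_r=[n]$. A strategy of length $n$ is a sequence $S=(S[1],\dots,S[n])$ with $S[k]$ a permutation of $[k]$; if $\mathcal{I}_r=\{i_1<\dots<i_k\}\neq\emptyset$ and $\sigma=S[k]$, then $\gamma_{r+1}(i)=\gamma_r(i)$ for $i\in\mathcal{J}_r$ and $\gamma_{r+1}(i_{\sigma(j)})=\gamma_r(i_j)$ for $j=1,\dots,k$. The cyclic shift strategy $CS$ has $CS[k]=[2,3,\dots,k,1]$. An inductive strategy of length $n$ has $S[k]=CS[k]$ for $1\le k\le n-1$ and $S[n]$ an arbitrary cyclic permutation (single $n$-cycle) of $[n]$. $CSL$ is the inductive strategy with $CSL[n]=[n,1,2,\dots,n-1]$. For a secret $\pi$, $\rho_S(\pi)=\min\{i:\mathcal{J}_i\neq\emptyset\}$.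 *)

theory Defs
  imports Main "HOL-Combinatorics.Permutations" "HOL-Combinatorics.Orbits"
begin

text \<open>
  A permutation of \<open>{1..k}\<close> is a function \<open>p :: nat \<Rightarrow> nat\<close> with \<open>p permutes {1..k}\<close>
  (so \<open>p\<close> is the identity outside \<open>{1..k}\<close>); its one-line notation is \<open>[p 1, \<dots>, p k]\<close>.
  A strategy is a function \<open>S\<close> whose value \<open>S k\<close> is the permutation of \<open>{1..k}\<close> applied to
  \<open>k\<close> wrong positions; for a strategy of length \<open>n\<close> only the values \<open>S 1, \<dots>, S n\<close> matter.
\<close>

type_synonym strategy = "nat \<Rightarrow> nat \<Rightarrow> nat"

definition is_strategy :: "nat \<Rightarrow> strategy \<Rightarrow> bool" where
  "is_strategy n S \<longleftrightarrow> (\<forall>k\<in>{1..n}. S k permutes {1..k})"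

text \<open>In one-line notation, \<open>CS k\<close> is \<open>[2, 3, \<dots>, k, 1]\<close>.\<close>

definition CS :: strategy where
  "CS k i = (if i \<in> {1..k} then if i = k then 1 else i + 1 else i)"

text \<open>In one-line notation, \<open>CSL n n\<close> is \<open>[n, 1, 2, \<dots>, n - 1]\<close>.\<close>

definition CSL :: "nat \<Rightarrow> strategy" where
  "CSL n = CS(n := (\<lambda>i. if i \<in> {1..n} then if i = 1 then n else i - 1 else i))"

definition inductive_strategy :: "nat \<Rightarrow> strategy \<Rightarrow> bool" where
  "inductive_strategy n S \<longleftrightarrow>
     is_strategy n S \<and> (\<forall>k\<in>{1..<n}. S k = CS k) \<and> cyclic_on (S n) {1..n}"

text \<open>The positions at which a guess \<open>g\<close> is correct, respectively wrong, for the secret \<open>p\<close>.\<close>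

definition correct_pos :: "nat \<Rightarrow> (nat \<Rightarrow> nat) \<Rightarrow> (nat \<Rightarrow> nat) \<Rightarrow> nat set" where
  "correct_pos n p g = {i \<in> {1..n}. g i = p i}"

definition wrong_pos :: "nat \<Rightarrow> (nat \<Rightarrow> nat) \<Rightarrow> (nat \<Rightarrow> nat) \<Rightarrow> nat set" where
  "wrong_pos n p g = {1..n} - correct_pos n p g"

text \<open>The \<open>j\<close>-th smallest element of a finite set of naturals, counting from \<open>1\<close>.\<close>

definition nth_smallest :: "nat set \<Rightarrow> nat \<Rightarrow> nat" where
  "nth_smallest I j = sorted_list_of_set I ! (j - 1)"

text \<open>
  Writing \<open>i\<^sub>j\<close> for \<open>nth_smallest I j\<close> and \<open>\<sigma>\<close> for \<open>S (card I)\<close>, the new guess at the wrong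
  position \<open>i = i\<^bsub>\<sigma> j\<^esub>\<close> is the old guess at \<open>i\<^sub>j\<close>; see \<open>next_guess_wrong\<close> below.
\<close>

definition next_guess :: "strategy \<Rightarrow> nat \<Rightarrow> (nat \<Rightarrow> nat) \<Rightarrow> (nat \<Rightarrow> nat) \<Rightarrow> (nat \<Rightarrow> nat)" where
  "next_guess S n p g =
     (let I = wrong_pos n p g; \<sigma> = S (card I) in
      (\<lambda>i. if i \<in> I
          then g (nth_smallest I (THE j. j \<in> {1..card I} \<and> nth_smallest I (\<sigma> j) = i))
          else g i))"

text \<open>
  Guesses are numbered from \<open>1\<close>; the value at \<open>r = 0\<close> is meaningless. Once a guess is fully
  correct, the sequence stays constant.
\<close>

definition guess :: "strategy \<Rightarrow> nat \<Rightarrow> (nat \<Rightarrow> nat) \<Rightarrow> nat \<Rightarrow> (nat \<Rightarrow> nat)" where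
  "guess S n p r = (next_guess S n p ^^ (r - 1)) id"

definition feedback :: "strategy \<Rightarrow> nat \<Rightarrow> (nat \<Rightarrow> nat) \<Rightarrow> nat \<Rightarrow> nat set" where
  "feedback S n p r = correct_pos n p (guess S n p r)"

definition ends_after :: "strategy \<Rightarrow> nat \<Rightarrow> (nat \<Rightarrow> nat) \<Rightarrow> nat \<Rightarrow> bool" where
  "ends_after S n p r \<longleftrightarrow>
     1 \<le> r \<and> feedback S n p r = {1..n} \<and> (\<forall>q\<in>{1..<r}. feedback S n p q \<noteq> {1..n})"

definition rho :: "strategy \<Rightarrow> nat \<Rightarrow> (nat \<Rightarrow> nat) \<Rightarrow> nat" where
  "rho S n p = (LEAST i. 1 \<le> i \<and> feedback S n p i \<noteq> {})"

definition num_three_rho_two :: "strategy \<Rightarrow> nat \<Rightarrow> nat" where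
  "num_three_rho_two S n =
     card {p. p permutes {1..n} \<and> ends_after S n p 3 \<and> rho S n p = 2}"

lemma bij_betw_nth_smallest:
  assumes "finite I"
  shows "bij_betw (nth_smallest I) {1..card I} I"
proof -
  have 1: "bij_betw (\<lambda>j. j - 1) {1..card I} {..<card I}"
    by (rule bij_betwI[where g = Suc]) auto
  have 2: "bij_betw ((!) (sorted_list_of_set I)) {..<card I} I"
    using assms by (intro bij_betw_nth) auto
  show ?thesis
    using bij_betw_trans[OF 1 2] by (simp add: comp_def nth_smallest_def[abs_def])
qed

lemma next_guess_correct:
  assumes "i \<in> correct_pos n p g"
  shows "next_guess S n p g i = g i"
  using assms by (simp add: next_guess_def wrong_pos_def Let_def)

lemma next_guess_wrong:
  fixes S n p g
  defines "I \<equiv> wrong_pos n p g"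
  assumes \<sigma>: "S (card I) permutes {1..card I}" and j: "j \<in> {1..card I}"
  shows "next_guess S n p g (nth_smallest I (S (card I) j)) = g (nth_smallest I j)"
proof -
  have b: "bij_betw (nth_smallest I) {1..card I} I"
    by (rule bij_betw_nth_smallest) (simp add: I_def wrong_pos_def)
  have bs: "bij_betw (\<lambda>j. nth_smallest I (S (card I) j)) {1..card I} I"
    using bij_betw_trans[OF permutes_imp_bij[OF \<sigma>] b] by (simp add: comp_def)
  have "(THE l. l \<in> {1..card I} \<and>
           nth_smallest I (S (card I) l) = nth_smallest I (S (card I) j)) = j"
    using j bij_betw_imp_inj_on[OF bs] by (intro the_equality) (auto dest: inj_onD)
  moreover have "nth_smallest I (S (card I) j) \<in> I"
    using bij_betwE[OF bs] j by blast
  ultimately show ?thesis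
    by (simp add: next_guess_def Let_def I_def)
qed

end

theory Submission
  imports Defs
begin

text \<open>
  A secret won at the third guess with \<open>rho = 2\<close> is determined by the set \<open>I\<close> of positions that are
  wrong at the second guess. With \<open>\<sigma> = S n\<close>, the sets that occur are the proper subsets of \<open>{1..n}\<close>
  with at least two elements such that \<open>\<sigma> b \<noteq> a\<close> whenever \<open>b\<close> is the cyclic successor of \<open>a\<close>
  within \<open>I\<close>. For \<open>CSL\<close> this means that \<open>I\<close> has no two cyclically adjacent elements. Such a set \<open>J\<close>
  is made good for \<open>\<sigma>\<close> by inserting \<open>b - 1\<close> for each offending pair \<open>a, b\<close>. The result is a proper
  subset, since otherwise \<open>J\<close> would be closed under the \<open>n\<close>-cycle \<open>\<sigma>\<close>, and the map is injective.
  It is not onto: if some \<open>x\<close> has \<open>\<sigma> (x + 1) \<noteq> x\<close> and \<open>\<sigma> x \<noteq> x + 1\<close>, it misses \<open>{x, x + 1}\<close>;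
  otherwise \<open>\<sigma> \<noteq> CSL n n\<close> forces \<open>\<sigma> = CS n\<close>, and it misses \<open>{1, 2, 4}\<close>.
\<close>

text \<open>
  Betweenness in cyclic order, going up from \<open>a\<close> to \<open>b\<close>; for \<open>a = b\<close> it holds for all \<open>x \<noteq> a\<close>.
\<close>

definition strictly_between :: "nat \<Rightarrow> nat \<Rightarrow> nat \<Rightarrow> bool" where
  "strictly_between a b x \<longleftrightarrow> (a < x \<and> x < b) \<or> (b \<le> a \<and> (a < x \<or> x < b))"

text \<open>A relation rather than a function, so that claims about successors reduce to comparing
  numbers. The element of a singleton succeeds itself.\<close>

definition next_in :: "nat set \<Rightarrow> nat \<Rightarrow> nat \<Rightarrow> bool" where
  "next_in I a b \<longleftrightarrow> a \<in> I \<and> b \<in> I \<and> (\<forall>x\<in>I. \<not> strictly_between a b x)"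

text \<open>The last condition encodes that the first guess is wrong on \<open>I\<close>: the secret
  has the value \<open>inv \<sigma> a\<close> at \<open>b\<close>, and this must differ from
  \<open>b\<close>.\<close>

definition good_sets :: "(nat \<Rightarrow> nat) \<Rightarrow> nat \<Rightarrow> nat set set" where
  "good_sets \<sigma> n = {I. I \<subset> {1..n} \<and> 2 \<le> card I \<and> (\<forall>a b. next_in I a b \<longrightarrow> \<sigma> b \<noteq> a)}"

section \<open>Cyclic successors inside a finite set\<close>

lemma CS_permutes: "CS k permutes {1..k}"
proof (rule bij_imp_permutes)
  show "bij_betw (CS k) {1..k} {1..k}"
    by (rule bij_betwI[where g = "\<lambda>i. if i = 1 then k else i - 1"]) (auto simp: CS_def)
qed (auto simp: CS_def)

lemma CS_preimage:
  assumes "y \<in> {1..k}"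
  obtains x where "x \<in> {1..k}" "y = CS k x"
  using assms permutes_image[OF CS_permutes[of k]] by blast

lemma nth_smallest_less_iff:
  assumes "finite I" "i \<in> {1..card I}" "j \<in> {1..card I}"
  shows "nth_smallest I i < nth_smallest I j \<longleftrightarrow> i < j"
proof -
  have less: "nth_smallest I i < nth_smallest I j"
    if "i < j" "i \<in> {1..card I}" "j \<in> {1..card I}" for i j
    using that assms(1) unfolding nth_smallest_def
    by (intro sorted_wrt_nth_less[OF strict_sorted_list_of_set]) auto
  show ?thesis
    using less[of i j] less[of j i] assms by (metis less_asym linorder_less_linear)
qed

text \<open>\<open>CS (card I)\<close> transported to \<open>I\<close> along its increasing
  enumeration, and extended by the identity so that it is a permutation of all naturals.\<close>

definition shift :: "nat set \<Rightarrow> nat \<Rightarrow> nat" where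
  "shift I a = (if a \<in> I then
     nth_smallest I (CS (card I) (inv_into {1..card I} (nth_smallest I) a)) else a)"

lemma shift_nth_smallest:
  assumes "finite I" "j \<in> {1..card I}"
  shows "shift I (nth_smallest I j) = nth_smallest I (CS (card I) j)"
  using bij_betw_nth_smallest[OF assms(1)] assms
  by (simp add: shift_def bij_betw_inv_into_left bij_betw_apply)

lemma nth_smallest_cases:
  assumes "finite I" "a \<in> I"
  obtains j where "j \<in> {1..card I}" "a = nth_smallest I j"
  using bij_betw_nth_smallest[OF assms(1)] assms(2) unfolding bij_betw_def by blast

lemma shift_permutes:
  assumes "finite I"
  shows "shift I permutes I"
proof (rule bij_imp_permutes)
  let ?h = "nth_smallest I" and ?K = "{1..card I}"
  have h: "bij_betw ?h ?K I" by (rule bij_betw_nth_smallest[OF assms])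
  have "bij_betw (?h \<circ> (CS (card I) \<circ> inv_into ?K ?h)) I I"
    by (intro bij_betw_trans[OF bij_betw_trans[OF bij_betw_inv_into[OF h]
          permutes_imp_bij[OF CS_permutes]] h])
  then show "bij_betw (shift I) I I"
    by (rule iffD1[OF bij_betw_cong, rotated]) (simp add: shift_def)
qed (simp add: shift_def)

text \<open>The enumeration of \<open>I\<close> is increasing, so betweenness can be checked on
  indices, where \<open>CS\<close> adds one or wraps from the last to the first.\<close>

lemma next_in_shift:
  assumes "finite I" "a \<in> I"
  shows "next_in I a (shift I a)"
proof -
  obtain j where j: "j \<in> {1..card I}" "a = nth_smallest I j"
    using nth_smallest_cases[OF assms] .
  have b: "shift I a = nth_smallest I (CS (card I) j)"
    using shift_nth_smallest[OF assms(1) j(1)] j by simp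
  have bI: "shift I a \<in> I"
    using permutes_in_image[OF shift_permutes[OF assms(1)]] assms(2) by simp
  have "\<not> strictly_between a (shift I a) x" if "x \<in> I" for x
  proof -
    obtain i where i: "i \<in> {1..card I}" "x = nth_smallest I i"
      using nth_smallest_cases[OF assms(1) \<open>x \<in> I\<close>] .
    have c: "CS (card I) j \<in> {1..card I}"
      using permutes_in_image[OF CS_permutes] j(1) by blast
    have "a < x \<longleftrightarrow> j < i" "x < shift I a \<longleftrightarrow> i < CS (card I) j"
      "a < shift I a \<longleftrightarrow> j < CS (card I) j"
      unfolding b using i(1) j(1) c assms(1)
      by (simp_all add: i(2) j(2) nth_smallest_less_iff del: atLeastAtMost_iff)
    then show ?thesis
      using i(1) j(1) by (auto simp: strictly_between_def CS_def split: if_splits)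
  qed
  then show ?thesis using assms(2) bI by (simp add: next_in_def)
qed

lemma next_in_unique:
  assumes "next_in I a b" "next_in I a c"
  shows "b = c"
  using assms unfolding next_in_def strictly_between_def
  by (metis linorder_less_linear not_le_imp_less order.strict_trans2 order_le_less)

lemma next_in_iff_shift:
  assumes "finite I"
  shows "next_in I a b \<longleftrightarrow> a \<in> I \<and> b = shift I a"
  using next_in_shift[OF assms] next_in_unique by (metis next_in_def)

lemma not_next_in_self:
  assumes "2 \<le> card I"
  shows "\<not> next_in I a a"
proof
  assume *: "next_in I a a"
  then have "I \<subseteq> {a}" by (auto simp: next_in_def strictly_between_def)
  then have "card I \<le> 1" using card_mono[of "{a}" I] by simp
  then show False using assms by simp
qed

section \<open>The guesses, and the secrets being counted\<close>

lemma finite_wrong_pos [simp]: "finite (wrong_pos n p g)"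
  by (simp add: wrong_pos_def)

lemma next_guess_shift:
  assumes "S (card (wrong_pos n p g)) = CS (card (wrong_pos n p g))"
    and "a \<in> wrong_pos n p g"
  shows "next_guess S n p g (shift (wrong_pos n p g) a) = g a"
proof -
  let ?I = "wrong_pos n p g"
  obtain j where j: "j \<in> {1..card ?I}" "a = nth_smallest ?I j"
    using nth_smallest_cases[OF finite_wrong_pos assms(2)] .
  show ?thesis
    using next_guess_wrong[of S n p g j] assms(1) j CS_permutes
    by (simp add: shift_nth_smallest)
qed

text \<open>Correct positions keep their values, and every wrong position is the
  \<open>shift\<close> of a wrong position, so only the moved entries have to be compared with
  \<open>p\<close>.\<close>

lemma correct_next_guess_shift:
  assumes CS: "S (card (wrong_pos n p g)) = CS (card (wrong_pos n p g))"
  shows "correct_pos n p (next_guess S n p g) = {1..n} \<longleftrightarrow>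
    (\<forall>a\<in>wrong_pos n p g. p (shift (wrong_pos n p g) a) = g a)"
    (is "?L \<longleftrightarrow> ?R")
proof -
  let ?I = "wrong_pos n p g"
  have perm: "shift ?I permutes ?I" by (simp add: shift_permutes)
  have L: "?L \<longleftrightarrow> (\<forall>i\<in>{1..n}. next_guess S n p g i = p i)"
    by (auto simp: correct_pos_def)
  have sub: "?I \<subseteq> {1..n}" by (auto simp: wrong_pos_def)
  have ok: "next_guess S n p g i = p i" if "i \<in> {1..n}" "i \<notin> ?I" for i
    using that next_guess_correct[of i n p g S] by (auto simp: wrong_pos_def correct_pos_def)
  show ?thesis
  proof
    assume ?L
    then show ?R using L sub next_guess_shift[where S = S, OF CS] permutes_in_image[OF perm]
      by (metis subsetD)
  next
    assume R: ?R
    have "next_guess S n p g i = p i" if "i \<in> {1..n}" for i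
    proof (cases "i \<in> ?I")
      case True
      then obtain a where "a \<in> ?I" "i = shift ?I a"
        using permutes_image[OF perm] by (metis imageE)
      then show ?thesis using R next_guess_shift[where S = S, OF CS] by simp
    qed (use ok that in blast)
    then show ?L using L by blast
  qed
qed

lemma nth_smallest_atLeastAtMost:
  assumes "j \<in> {1..n}"
  shows "nth_smallest {1..n} j = j"
  using assms by (simp add: nth_smallest_def flip: atLeastLessThanSuc_atLeastAtMost del: upt_Suc)

text \<open>All positions are wrong, so positions and indices coincide and the value
  \<open>j\<close> moves to position \<open>S n j\<close>.\<close>

lemma next_guess_id_derangement:
  assumes \<sigma>: "S n permutes {1..n}" and "correct_pos n p id = {}"
  shows "next_guess S n p id = inv (S n)"
proof
  fix i
  have W: "wrong_pos n p id = {1..n}" using assms(2) by (simp add: wrong_pos_def)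
  show "next_guess S n p id i = inv (S n) i"
  proof (cases "i \<in> {1..n}")
    case True
    then obtain j where j: "j \<in> {1..n}" "i = S n j"
      using permutes_image[OF \<sigma>] by (metis imageE)
    then have "next_guess S n p id i = j"
      using next_guess_wrong[of S n p id j] \<sigma> True
        nth_smallest_atLeastAtMost[of i n] nth_smallest_atLeastAtMost[of j n]
      by (simp add: W)
    then show ?thesis using j permutes_inverses[OF \<sigma>] by simp
  next
    case False
    then show ?thesis
      using permutes_not_in[OF permutes_inv[OF \<sigma>]] W by (auto simp: next_guess_def Let_def)
  qed
qed

text \<open>If the first guess is wrong everywhere, the second guess is \<open>inv (S n)\<close> and
  \<open>I p\<close> is its set of wrong positions. That \<open>I p\<close> is not everything gives
  \<open>rho\<close> the value 2; that it is nonempty prevents an end at the second guess.\<close>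

lemma three_rho_two_iff:
  assumes "n \<ge> 1" "S n permutes {1..n}" and CS: "\<forall>k\<in>{1..<n}. S k = CS k"
  defines "I \<equiv> \<lambda>p. wrong_pos n p (inv (S n))"
  shows "ends_after S n p 3 \<and> rho S n p = 2 \<longleftrightarrow>
    correct_pos n p id = {} \<and> I p \<noteq> {} \<and> I p \<noteq> {1..n} \<and>
    (\<forall>a\<in>I p. p (shift (I p) a) = inv (S n) a)"
proof -
  let ?F = "feedback S n p"
  have g1: "?F 1 = correct_pos n p id" "?F (Suc 0) = correct_pos n p id"
    by (simp_all add: feedback_def guess_def)
  have rho: "rho S n p = 2 \<longleftrightarrow> ?F 1 = {} \<and> ?F 2 \<noteq> {}" if "?F 3 = {1..n}"
  proof
    \<comment> \<open>Guess 3 is correct on a nonempty set, so the \<open>LEAST\<close> in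
      \<open>rho\<close> is attained.\<close>
    have ne: "1 \<le> (3::nat) \<and> ?F 3 \<noteq> {}" using that \<open>n \<ge> 1\<close> by auto
    assume r: "rho S n p = 2"
    show "?F 1 = {} \<and> ?F 2 \<noteq> {}"
      using r LeastI[of "\<lambda>i. 1 \<le> i \<and> ?F i \<noteq> {}", OF ne]
        not_less_Least[of 1 "\<lambda>i. 1 \<le> i \<and> ?F i \<noteq> {}"]
      unfolding rho_def by force
  next
    assume f: "?F 1 = {} \<and> ?F 2 \<noteq> {}"
    show "rho S n p = 2"
      unfolding rho_def
    proof (rule Least_equality)
      fix i assume "1 \<le> i \<and> ?F i \<noteq> {}"
      then show "2 \<le> i" using f by (cases "i = 1") auto
    qed (use f in simp)
  qed
  have q: "{1..<3::nat} = {1, 2}" by auto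
  have ne: "{1..n} \<noteq> {}" using \<open>n \<ge> 1\<close> by simp
  have ends: "ends_after S n p 3 \<and> rho S n p = 2 \<longleftrightarrow>
      ?F 1 = {} \<and> ?F 2 \<noteq> {} \<and> ?F 2 \<noteq> {1..n} \<and> ?F 3 = {1..n}"
    unfolding ends_after_def q using rho ne by fastforce
  show ?thesis
  proof (cases "?F 1 = {}")
    case True
    then have d: "next_guess S n p id = inv (S n)"
      using next_guess_id_derangement assms(2) g1 by metis
    have F2: "?F 2 = correct_pos n p (inv (S n))"
      by (simp add: feedback_def guess_def d)
    have F3: "?F 3 = correct_pos n p (next_guess S n p (inv (S n)))"
      by (simp add: feedback_def guess_def numeral_2_eq_2 d)
    have sub: "?F 2 \<subseteq> {1..n}" "I p = {1..n} - ?F 2"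
      by (auto simp: F2 I_def wrong_pos_def correct_pos_def)
    then have I2: "?F 2 \<noteq> {} \<longleftrightarrow> I p \<noteq> {1..n}" "?F 2 \<noteq> {1..n} \<longleftrightarrow> I p \<noteq> {}" by auto
    have "?F 3 = {1..n} \<longleftrightarrow> (\<forall>a\<in>I p. p (shift (I p) a) = inv (S n) a)"
      if "I p \<noteq> {}" "I p \<noteq> {1..n}"
    proof -
      have fin: "finite (I p)" "I p \<subset> {1..n}"
        using that sub(2) by (auto simp: I_def)
      \<comment> \<open>Some but not all positions are wrong, so the third guess is formed with
        \<open>CS\<close>, whatever \<open>S n\<close> is.\<close>
      then have "card (I p) \<in> {1..<n}"
        using that psubset_card_mono[of "{1..n}" "I p"] by (simp add: Suc_le_eq card_gt_0_iff)
      then show ?thesis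
        using CS correct_next_guess_shift[of S n p "inv (S n)"] by (simp add: I_def F3)
    qed
    then show ?thesis using ends I2 True g1 by auto
  qed (use ends g1 in auto)
qed

text \<open>The set of wrong positions at the second guess determines the third guess, hence the
  secret. Outside that set the secret agrees with \<open>inv (S n)\<close>, so \<open>nofix\<close>
  makes the first guess wrong there as well.\<close>

lemma num_three_rho_two_eq_card_good_sets:
  assumes "n \<ge> 1" and \<sigma>: "S n permutes {1..n}" and "\<forall>k\<in>{1..<n}. S k = CS k"
    and nofix: "\<forall>i\<in>{1..n}. S n i \<noteq> i"
  shows "num_three_rho_two S n = card (good_sets (S n) n)"
proof -
  let ?\<tau> = "inv (S n)"
  let ?I = "\<lambda>p. wrong_pos n p ?\<tau>"
  \<comment> \<open>\<open>?P I\<close> is the third guess made when \<open>I\<close> is the set of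
    wrong positions at the second.\<close>
  let ?P = "\<lambda>I. ?\<tau> \<circ> inv (shift I)"
  have \<tau>: "?\<tau> permutes {1..n}" by (rule permutes_inv[OF \<sigma>])
  have inv: "S n (?\<tau> x) = x" "?\<tau> (S n x) = x" for x
    using permutes_inverses[OF \<sigma>] by simp_all
  have nofix': "?\<tau> i \<noteq> i" if "i \<in> {1..n}" for i using nofix inv that by metis
  define A where "A = {p. p permutes {1..n} \<and> correct_pos n p id = {} \<and> ?I p \<noteq> {} \<and>
    ?I p \<noteq> {1..n} \<and> (\<forall>a\<in>?I p. p (shift (?I p) a) = ?\<tau> a)}"
  have "bij_betw ?I A (good_sets (S n) n)"
  proof (rule bij_betwI[where g = ?P])
    show "?I \<in> A \<rightarrow> good_sets (S n) n"
    proof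
      fix p assume p: "p \<in> A"
      have sub: "?I p \<subset> {1..n}" using p by (auto simp: A_def wrong_pos_def)
      have ch: "p b = ?\<tau> a" if "next_in (?I p) a b" for a b
        using that p by (auto simp: next_in_iff_shift A_def)
      have "S n b \<noteq> a" if "next_in (?I p) a b" for a b
      proof -
        have "b \<in> {1..n}" using that sub by (auto simp: next_in_def)
        then have "p b \<noteq> b" using p by (auto simp: A_def correct_pos_def)
        then show ?thesis using ch[OF that] inv by metis
      qed
      \<comment> \<open>With a single wrong position, \<open>CS\<close> would only repeat the second
        guess.\<close>
      moreover have "2 \<le> card (?I p)"
      proof (rule ccontr)
        assume "\<not> 2 \<le> card (?I p)"
        moreover have "card (?I p) \<noteq> 0" using p by (simp add: A_def)
        ultimately have "card (?I p) = 1" by linarith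
        then obtain a where a: "?I p = {a}" by (rule card_1_singletonE)
        then have "next_in (?I p) a a" by (simp add: next_in_def strictly_between_def)
        then have "p a = ?\<tau> a" by (rule ch)
        then show False using a by (auto simp: wrong_pos_def correct_pos_def)
      qed
      ultimately show "?I p \<in> good_sets (S n) n" using sub by (simp add: good_sets_def)
    qed
  next
    have P_props: "?P I \<in> A \<and> ?I (?P I) = I" if I: "I \<in> good_sets (S n) n" for I
    proof -
      have sub: "I \<subset> {1..n}" and c: "2 \<le> card I"
        and gd: "\<And>a b. next_in I a b \<Longrightarrow> S n b \<noteq> a"
        using I by (auto simp: good_sets_def)
      have fin: "finite I" using sub finite_subset by blast
      note q = shift_permutes[OF fin]
      have perm: "?P I permutes {1..n}"
        using permutes_compose[OF permutes_subset[OF permutes_inv[OF q]] \<tau>] sub by blast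
      have out: "?P I i = ?\<tau> i" if "i \<notin> I" for i
        using permutes_not_in[OF permutes_inv[OF q] that] by simp
      have inn: "?P I (shift I a) = ?\<tau> a" for a
        using permutes_inverses[OF q] by simp
      have ex: "\<exists>a. next_in I a i \<and> ?P I i = ?\<tau> a" if "i \<in> I" for i
      proof -
        obtain a where "a \<in> I" "i = shift I a"
          using permutes_image[OF q] \<open>i \<in> I\<close> by (metis imageE)
        then show ?thesis using inn next_in_shift[OF fin] by metis
      qed
      \<comment> \<open>The value at \<open>i\<close> comes from the predecessor of \<open>i\<close>
        in \<open>I\<close>, which differs from \<open>i\<close> because \<open>I\<close> has at
        least two elements.\<close>
      have "?P I i \<noteq> ?\<tau> i" if "i \<in> I" for i
        using ex[OF that] inv not_next_in_self[OF c] by metis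
      then have W: "?I (?P I) = I"
        using out sub by (fastforce simp: wrong_pos_def correct_pos_def simp del: comp_apply)
      have nofixP: "?P I i \<noteq> i" if "i \<in> {1..n}" for i
      proof (cases "i \<in> I")
        case True
        then show ?thesis using ex[OF True] inv gd by metis
      qed (use out nofix' that in simp)
      have "correct_pos n (?P I) id = {}"
      proof (rule equals0I)
        fix i assume "i \<in> correct_pos n (?P I) id"
        then have "i \<in> {1..n}" "?P I i = i" unfolding correct_pos_def by simp_all
        then show False using nofixP by blast
      qed
      moreover have "I \<noteq> {}" using c by auto
      ultimately show ?thesis
        unfolding A_def mem_Collect_eq W using perm sub inn by blast
    qed
    show "?P \<in> good_sets (S n) n \<rightarrow> A" using P_props by blast
    show "?I (?P I) = I" if "I \<in> good_sets (S n) n" for I using P_props[OF that] by blast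
    show "?P (?I p) = p" if p: "p \<in> A" for p
    proof
      fix i
      note q = shift_permutes[OF finite_wrong_pos[of n p ?\<tau>]]
      show "?P (?I p) i = p i"
      proof (cases "i \<in> ?I p")
        case True
        then obtain a where "a \<in> ?I p" "i = shift (?I p) a"
          using permutes_image[OF q] by (metis imageE)
        then show ?thesis using p permutes_inverses[OF q] by (simp add: A_def)
      next
        case False
        have "p i = ?\<tau> i"
        proof (cases "i \<in> {1..n}")
          case True
          then show ?thesis using False by (auto simp: wrong_pos_def correct_pos_def)
        next
          case False
          moreover have "p permutes {1..n}" using p by (simp add: A_def)
          ultimately show ?thesis using permutes_not_in \<tau> by metis
        qed
        then show ?thesis using permutes_not_in[OF permutes_inv[OF q] False] by simp
      qed
    qed
  qed
  moreover have "{p. p permutes {1..n} \<and> ends_after S n p 3 \<and> rho S n p = 2} = A"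
    using three_rho_two_iff[OF assms(1-3)] by (auto simp: A_def)
  ultimately show ?thesis by (simp add: num_three_rho_two_def bij_betw_same_card)
qed

section \<open>Sets closed under a cycle, and adjacency in good sets for \<open>CSL\<close>\<close>

lemma CS_closed_eq:
  assumes "T \<subseteq> {1..n}" "T \<noteq> {}" "\<And>x. x \<in> T \<Longrightarrow> CS n x \<in> T"
  shows "T = {1..n}"
proof -
  have step: "Suc x \<in> T" if "x \<in> T" "x < n" for x
    using assms(3)[OF that(1)] that assms(1) by (auto simp: CS_def split: if_splits)
  have up: "y \<in> T" if "x \<le> y" "x \<in> T" "y \<le> n" for x y
    using that by (induction rule: dec_induct) (auto intro: step)
  obtain x where "x \<in> T" using assms(2) by blast
  then have "n \<in> T" "1 \<le> n" using up[of x n] assms(1) by force+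
  then have "1 \<in> T" using assms(3)[of n] by (simp add: CS_def)
  then show ?thesis using up[of 1] assms(1) by auto
qed

lemma cyclic_on_closed_eq:
  assumes "cyclic_on f A" "J \<subseteq> A" "J \<noteq> {}" "\<And>x. x \<in> J \<Longrightarrow> f x \<in> J"
  shows "J = A"
proof -
  obtain x where x: "x \<in> J" using assms(3) by blast
  then have "A = orbit f x"
    using assms(1,2) orbit_cyclic_eq3 by (metis subsetD)
  moreover have "y \<in> J" if "y \<in> orbit f x" for y
    using that by induction (use x assms(4) in auto)
  ultimately show ?thesis using assms(2) by blast
qed

lemma next_in_CS:
  assumes "I \<subseteq> {1..n}" "x \<in> I" "CS n x \<in> I"
  shows "next_in I x (CS n x)"
  using assms by (fastforce simp: next_in_def strictly_between_def CS_def)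

lemma CSL_CS:
  assumes "x \<in> {1..n}"
  shows "CSL n n (CS n x) = x"
  using assms by (auto simp: CSL_def CS_def)

lemma CSL_permutes: "CSL n n permutes {1..n}"
proof (rule bij_imp_permutes)
  show "bij_betw (CSL n n) {1..n} {1..n}"
    by (rule bij_betwI[where g = "CS n"]) (auto simp: CSL_def CS_def)
qed (auto simp: CSL_def)

text \<open>\<open>CSL n n\<close> inverts \<open>CS n\<close>, so two adjacent elements would form
  an offending pair.\<close>

lemma good_sets_CSL_no_adjacent:
  assumes "J \<in> good_sets (CSL n n) n" "x \<in> J"
  shows "CS n x \<notin> J"
  using assms next_in_CS[of J n x] CSL_CS[of x n] by (fastforce simp: good_sets_def)

section \<open>The map that inserts an element into each offending gap\<close>

definition gap_fill :: "(nat \<Rightarrow> nat) \<Rightarrow> nat \<Rightarrow> nat set \<Rightarrow> nat set" where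
  "gap_fill \<sigma> n J = J \<union> {x \<in> {1..n}. next_in J (\<sigma> (CS n x)) (CS n x)}"

text \<open>If \<open>c\<close>, \<open>b\<close> were an offending pair of the enlarged set, the
  cases are which of the two are old. Two old elements already have an insertion between them; a new
  element would contradict the offending pair that caused its insertion.\<close>

lemma gap_fill_good:
  assumes "n \<ge> 1" and \<sigma>: "\<sigma> permutes {1..n}" "cyclic_on \<sigma> {1..n}" "\<forall>i\<in>{1..n}. \<sigma> i \<noteq> i"
    and J: "J \<subseteq> {1..n}" "2 \<le> card J" "\<And>x. x \<in> J \<Longrightarrow> CS n x \<notin> J"
  shows "gap_fill \<sigma> n J \<in> good_sets \<sigma> n"
proof -
  let ?K = "gap_fill \<sigma> n J"
  have sub: "?K \<subseteq> {1..n}" "J \<subseteq> ?K" using J(1) by (auto simp: gap_fill_def)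
  have inserted: "next_in J (\<sigma> (CS n x)) (CS n x)" if "x \<in> ?K" "x \<notin> J" for x
    using that by (auto simp: gap_fill_def)
  have neJ: "J \<noteq> {}" using J(2) by auto
  have "?K \<noteq> {1..n}"
  proof
    assume full: "?K = {1..n}"
    \<comment> \<open>The element just before \<open>b\<close> is not in \<open>J\<close>, so it was
      inserted, and that requires \<open>\<sigma> b\<close> to be the predecessor of
      \<open>b\<close> in \<open>J\<close>.\<close>
    have "\<sigma> b \<in> J" if "b \<in> J" for b
    proof -
      have "b \<in> {1..n}" using that J(1) by blast
      then obtain x where x: "x \<in> {1..n}" "b = CS n x" by (rule CS_preimage)
      then have "x \<notin> J" using J(3) that by blast
      then show ?thesis using inserted[of x] x full by (simp add: next_in_def)
    qed
    then have "J = {1..n}" using cyclic_on_closed_eq[OF \<sigma>(2) J(1) neJ] by blast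
    then show False using J(3) neJ permutes_in_image[OF CS_permutes[of n]] by blast
  qed
  moreover have "2 \<le> card ?K"
    using card_mono[OF _ sub(2)] finite_subset[OF sub(1)] J(2) by force
  moreover have "\<sigma> b \<noteq> c" if cb: "next_in ?K c b" for b c
  proof
    assume eq: "\<sigma> b = c"
    have K: "c \<in> ?K" "b \<in> ?K" and gap: "\<And>x. x \<in> ?K \<Longrightarrow> \<not> strictly_between c b x"
      using cb by (auto simp: next_in_def)
    have rng: "c \<in> {1..n}" "b \<in> {1..n}" using K sub by blast+
    have ne: "c \<noteq> b" using \<sigma>(3) rng eq by metis
    have nxc: "CS n c = b \<or> strictly_between c b (CS n c)"
      using rng ne by (auto simp: strictly_between_def CS_def)
    show False
    proof (cases "b \<in> J")
      case bJ: True
      show False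
      proof (cases "c \<in> J")
        case True
        obtain x where x: "x \<in> {1..n}" "b = CS n x" using CS_preimage[OF rng(2)] .
        have "next_in J c b" using True bJ gap sub(2) by (auto simp: next_in_def)
        then have xK: "x \<in> ?K" using x eq by (simp add: gap_fill_def)
        have "x \<noteq> c" using J(3) True x bJ by blast
        then have "strictly_between c b x"
          using x rng ne by (auto simp: strictly_between_def CS_def split: if_splits)
        then show False using gap xK by blast
      next
        case False
        then have "CS n c \<in> J" "\<sigma> (CS n c) \<in> J" using inserted[OF K(1)] by (auto simp: next_in_def)
        \<comment> \<open>Nothing in the enlarged set lies between \<open>c\<close> and
          \<open>b\<close>, so the successor that caused the insertion of \<open>c\<close> is
          \<open>b\<close> itself; then \<open>c = \<sigma> b\<close> would be old.\<close>
        moreover from this have "CS n c = b" using nxc gap sub(2) by blast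
        ultimately show False using eq False by simp
      qed
    next
      case False
      define e where "e = CS n b"
      define a where "a = \<sigma> e"
      have ae: "next_in J a e" using inserted[OF K(2) False] by (simp add: e_def a_def)
      have aJ: "a \<in> J" "e \<in> J" "\<And>x. x \<in> J \<Longrightarrow> \<not> strictly_between a e x"
        using ae by (auto simp: next_in_def)
      have ar: "a \<in> {1..n}" "e \<in> {1..n}" using aJ J(1) by blast+
      have "b \<noteq> e" using False aJ by blast
      then have "a \<noteq> c" using eq permutes_inj[OF \<sigma>(1)] unfolding a_def by (metis injD)
      moreover have "\<not> strictly_between c b a" using gap aJ(1) sub(2) by blast
      moreover have "a \<noteq> b" using False aJ by blast
      moreover have "a \<noteq> e" using \<sigma>(3) ar unfolding a_def by metis
      \<comment> \<open>The cyclic order is \<open>a\<close>, \<open>c\<close>, \<open>b\<close>,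
        \<open>e\<close> with \<open>e\<close> right after \<open>b\<close>. Hence \<open>c\<close>
        is new too, and its successor would be an element of \<open>J\<close> inside the gap from
        \<open>a\<close> to \<open>e\<close>.\<close>
      ultimately have cae: "strictly_between a e c" "strictly_between a e (CS n c)"
        using rng ar ne \<open>b \<noteq> e\<close> unfolding e_def
        by (auto simp: strictly_between_def CS_def split: if_splits)
      then have "c \<notin> J" using aJ by blast
      then have "CS n c \<in> J" using inserted[OF K(1)] by (auto simp: next_in_def)
      then show False using aJ(3) cae(2) by blast
    qed
  qed
  ultimately show ?thesis using sub(1) by (auto simp: good_sets_def)
qed

text \<open>
  If \<open>J\<close> and \<open>L\<close> have the same image, each \<open>x \<in> J - L\<close> was inserted into \<open>L\<close>, so its successor is in
  \<open>L - J\<close>; going round the circle, the common image would be everything.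
\<close>

lemma inj_on_gap_fill:
  assumes J: "\<And>J. J \<in> X \<Longrightarrow> J \<subseteq> {1..n}" "\<And>J x. J \<in> X \<Longrightarrow> x \<in> J \<Longrightarrow> CS n x \<notin> J"
    and proper: "\<And>J. J \<in> X \<Longrightarrow> gap_fill \<sigma> n J \<noteq> {1..n}"
  shows "inj_on (gap_fill \<sigma> n) X"
proof (rule inj_onI, rule ccontr)
  fix J L assume X: "J \<in> X" "L \<in> X" and eq: "gap_fill \<sigma> n J = gap_fill \<sigma> n L" and ne: "J \<noteq> L"
  have step: "CS n x \<in> L - J"
    if "J \<in> X" "L \<in> X" "gap_fill \<sigma> n J = gap_fill \<sigma> n L" "x \<in> J - L" for J L x
  proof -
    have "x \<in> gap_fill \<sigma> n L" using that(3,4) by (auto simp: gap_fill_def)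
    then have "CS n x \<in> L" using that(4) by (auto simp: gap_fill_def next_in_def)
    then show ?thesis using J(2) that by blast
  qed
  have "(J - L) \<union> (L - J) = {1..n}"
    using step[OF X eq] step[OF X(2,1) eq[symmetric]] J(1) X ne
    by (intro CS_closed_eq) blast+
  moreover have "J \<subseteq> gap_fill \<sigma> n J" "L \<subseteq> gap_fill \<sigma> n J" "gap_fill \<sigma> n J \<subseteq> {1..n}"
    using eq J(1) X by (auto simp: gap_fill_def)
  ultimately show False using proper[OF X(1)] by blast
qed

section \<open>A good set outside the image\<close>

lemma good_set_not_gap_fill:
  assumes n: "n \<ge> 4" and \<sigma>: "\<sigma> permutes {1..n}" "\<forall>i\<in>{1..n}. \<sigma> i \<noteq> i" "\<sigma> \<noteq> CSL n n"
  obtains W where "W \<in> good_sets \<sigma> n"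
    "\<And>J. J \<subseteq> {1..n} \<Longrightarrow> (\<And>x. x \<in> J \<Longrightarrow> CS n x \<notin> J) \<Longrightarrow> gap_fill \<sigma> n J \<noteq> W"
proof (cases "\<exists>x\<in>{1..n}. \<sigma> (CS n x) \<noteq> x \<and> \<sigma> x \<noteq> CS n x")
  case True
  then obtain x where x: "x \<in> {1..n}" and ne: "\<sigma> (CS n x) \<noteq> x" "\<sigma> x \<noteq> CS n x" by blast
  have rng: "CS n x \<in> {1..n}" using x permutes_in_image[OF CS_permutes] by blast
  have dist: "CS n x \<noteq> x" "CS n (CS n x) \<noteq> x" "CS n (CS n x) \<noteq> CS n x"
    using x n by (auto simp: CS_def)
  let ?W = "{x, CS n x}"
  have "card ?W = 2" using dist by simp
  moreover have "?W \<noteq> {1..n}" using calculation n by (metis card_atLeastAtMost diff_Suc_1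
      numeral_le_iff semiring_norm(69) semiring_norm(71))
  moreover have "\<sigma> b \<noteq> a" if "next_in ?W a b" for a b
  proof -
    have "a \<in> ?W" "b \<in> ?W" using that by (auto simp: next_in_def)
    then show ?thesis using \<sigma>(2) x rng ne by (elim insertE emptyE) simp_all
  qed
  ultimately have "?W \<in> good_sets \<sigma> n" using x rng by (auto simp: good_sets_def)
  moreover have "gap_fill \<sigma> n J \<noteq> ?W"
    if J: "J \<subseteq> {1..n}" "\<And>x. x \<in> J \<Longrightarrow> CS n x \<notin> J" for J
  proof
    assume eq: "gap_fill \<sigma> n J = ?W"
    have sub: "J \<subseteq> ?W" using eq by (auto simp: gap_fill_def)
    \<comment> \<open>Otherwise \<open>CS n x\<close> was inserted and its successor, which is
      outside \<open>?W\<close>, would be in \<open>J\<close>. Then \<open>x\<close> is not in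
      \<open>J\<close>, so it was inserted, which puts \<open>\<sigma> (CS n x)\<close> into
      \<open>?W\<close>.\<close>
    have "CS n x \<in> J"
      using eq sub dist by (auto simp: gap_fill_def next_in_def)
    moreover from this have "\<sigma> (CS n x) \<in> J"
      using eq J(2) by (auto simp: gap_fill_def next_in_def)
    ultimately show False using sub ne \<sigma>(2) rng by blast
  qed
  ultimately show thesis using that by blast
next
  case False
  then have alt: "\<sigma> (CS n x) = x \<or> \<sigma> x = CS n x" if "x \<in> {1..n}" for x using that by blast
  define T where "T = {x \<in> {1..n}. \<sigma> (CS n x) = x}"
  have "T = {}"
  proof (rule ccontr)
    assume "T \<noteq> {}"
    \<comment> \<open>The other alternative at \<open>CS n x\<close> would give
      \<open>CS n (CS n x) = x\<close>. So \<open>T\<close> is empty or everything, and everything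
      would mean \<open>\<sigma> = CSL n n\<close>.\<close>
    have step: "CS n x \<in> T" if "x \<in> T" for x
    proof -
      have x: "x \<in> {1..n}" "\<sigma> (CS n x) = x" using that by (auto simp: T_def)
      then have "CS n x \<in> {1..n}" "CS n (CS n x) \<noteq> x" using n by (auto simp: CS_def)
      then show ?thesis using alt[of "CS n x"] x by (auto simp: T_def)
    qed
    have "T \<subseteq> {1..n}" unfolding T_def by blast
    then have T: "T = {1..n}" using \<open>T \<noteq> {}\<close> step by (rule CS_closed_eq)
    have "\<sigma> y = CSL n n y" for y
    proof (cases "y \<in> {1..n}")
      case True
      then obtain x where "x \<in> {1..n}" "y = CS n x" by (rule CS_preimage)
      moreover from this have "\<sigma> (CS n x) = x" using T unfolding T_def by blast
      ultimately show ?thesis using CSL_CS by simp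
    next
      case False
      then show ?thesis using permutes_not_in \<sigma>(1) CSL_permutes by metis
    qed
    then show False using \<sigma>(3) by blast
  qed
  then have \<sigma>CS: "\<sigma> x = CS n x" if "x \<in> {1..n}" for x
    using alt[OF that] that unfolding T_def by blast
  \<comment> \<open>Omitting 3 keeps the set proper even for \<open>n = 4\<close>, and also prevents
    1 and 2 from being inserted: this would need 3 in \<open>J\<close>, as \<open>\<sigma> 2\<close>
    or as \<open>CS n 2\<close>.\<close>
  let ?W = "{1, 2, 4::nat}"
  have W: "\<sigma> 1 = 2" "\<sigma> 2 = 3" "\<sigma> 4 = (if n = 4 then 1 else 5)" "CS n 1 = 2" "CS n 2 = 3"
    using n by (simp_all add: \<sigma>CS CS_def)
  have "\<sigma> b \<noteq> a" if "next_in ?W a b" for a b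
  proof -
    have "a = 1 \<and> b = 2 \<or> a = 2 \<and> b = 4 \<or> a = 4 \<and> b = 1"
      using that by (auto simp: next_in_def strictly_between_def)
    then show ?thesis using W(1-3) by (elim disjE conjE) (simp_all only:, simp_all)
  qed
  moreover have "?W \<subset> {1..n}"
  proof -
    have "3 \<in> {1..n}" "3 \<notin> ?W" using n by auto
    then show ?thesis using n by (intro psubsetI) auto
  qed
  ultimately have "?W \<in> good_sets \<sigma> n" by (simp add: good_sets_def)
  moreover have "gap_fill \<sigma> n J \<noteq> ?W"
    if J: "J \<subseteq> {1..n}" "\<And>x. x \<in> J \<Longrightarrow> CS n x \<notin> J" for J
  proof
    assume eq: "gap_fill \<sigma> n J = ?W"
    have sub: "J \<subseteq> ?W" using eq by (auto simp: gap_fill_def)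
    have K: "2 \<in> gap_fill \<sigma> n J" "1 \<in> gap_fill \<sigma> n J" using eq by simp_all
    have "x \<in> J" if "x \<in> gap_fill \<sigma> n J" "CS n x \<in> J \<Longrightarrow> \<sigma> (CS n x) \<notin> J" for x
      using that unfolding gap_fill_def next_in_def by blast
    moreover have "3 \<notin> J" using sub by auto
    ultimately have "2 \<in> J" "1 \<in> J" using K W by metis+
    then show False using J(2)[of 1] W(4) by simp
  qed
  ultimately show thesis using that by blast
qed

theorem theorem4p11:
  fixes n :: nat and S :: strategy
  assumes "n \<ge> 4"
    and "inductive_strategy n S"
    and "S n \<noteq> CSL n n"
  shows "num_three_rho_two S n > num_three_rho_two (CSL n) n"
proof -
  let ?\<sigma> = "S n" and ?X = "good_sets (CSL n n) n"
  have n1: "n \<ge> 1" using assms(1) by simp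
  have \<sigma>: "?\<sigma> permutes {1..n}" "cyclic_on ?\<sigma> {1..n}" "\<forall>k\<in>{1..<n}. S k = CS k"
    using assms(2) n1 by (auto simp: inductive_strategy_def is_strategy_def)
  have nofix: "\<forall>i\<in>{1..n}. ?\<sigma> i \<noteq> i"
  proof (intro ballI notI)
    fix i assume "i \<in> {1..n}" "?\<sigma> i = i"
    \<comment> \<open>A fixed point would be a closed set by itself.\<close>
    then have "{i} = {1..n}" using cyclic_on_closed_eq[OF \<sigma>(2), of "{i}"] by simp
    then have "card {1..n} = 1" by (metis card_1_singleton_iff One_nat_def)
    then show False using assms(1) by simp
  qed
  have eqs: "num_three_rho_two S n = card (good_sets ?\<sigma> n)"
    by (rule num_three_rho_two_eq_card_good_sets[OF n1 \<sigma>(1,3) nofix])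
  have eqL: "num_three_rho_two (CSL n) n = card ?X"
  proof (rule num_three_rho_two_eq_card_good_sets[OF n1])
    show "CSL n n permutes {1..n}" by (rule CSL_permutes)
    show "\<forall>k\<in>{1..<n}. CSL n k = CS k" by (simp add: CSL_def)
    show "\<forall>i\<in>{1..n}. CSL n n i \<noteq> i" using assms(1) by (auto simp: CSL_def)
  qed
  have X: "J \<subseteq> {1..n}" "2 \<le> card J" "\<And>x. x \<in> J \<Longrightarrow> CS n x \<notin> J" if "J \<in> ?X" for J
    using that good_sets_CSL_no_adjacent[OF that] by (auto simp: good_sets_def)
  have maps: "gap_fill ?\<sigma> n J \<in> good_sets ?\<sigma> n" if "J \<in> ?X" for J
    by (rule gap_fill_good[OF n1 \<sigma>(1,2) nofix X[OF that]])
  have proper: "gap_fill ?\<sigma> n J \<noteq> {1..n}" if "J \<in> ?X" for J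
    using maps[OF that] unfolding good_sets_def by blast
  have "inj_on (gap_fill ?\<sigma> n) ?X"
    by (rule inj_on_gap_fill[OF X(1) X(3) proper])
  then have "card ?X = card (gap_fill ?\<sigma> n ` ?X)" by (simp add: card_image)
  also have "\<dots> < card (good_sets ?\<sigma> n)"
  proof (rule psubset_card_mono)
    show "finite (good_sets ?\<sigma> n)"
      by (rule finite_subset[of _ "Pow {1..n}"]) (auto simp: good_sets_def)
    obtain W where "W \<in> good_sets ?\<sigma> n"
      "\<And>J. J \<subseteq> {1..n} \<Longrightarrow> (\<And>x. x \<in> J \<Longrightarrow> CS n x \<notin> J) \<Longrightarrow> gap_fill ?\<sigma> n J \<noteq> W"
      using good_set_not_gap_fill[OF assms(1) \<sigma>(1) nofix assms(3)] by blast
    moreover from this X(1,3) have "W \<notin> gap_fill ?\<sigma> n ` ?X" by (metis imageE)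
    ultimately show "gap_fill ?\<sigma> n ` ?X \<subset> good_sets ?\<sigma> n" using maps by blast
  qed
  finally show ?thesis by (simp add: eqs eqL)
qed

end
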